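(* Assume $\pi_w$ is continuous with full support on $[\underline w,\bar w]$, let $b>0$, and let $N_{\max}=\left\lfloor 1+\frac{\bar w-\underline w}{2b}\right\rfloor$. (1) The feasible one-dimensional equilibria are exactly the partitions $\underline w=t_0<t_1<\cdots<t_n=\bar w$ with $n\le N_{\max}$ satisfying $$t_i=\frac{\Phi(t_{i-1},t_i)+\Phi(t_i,t_{i+1})}{2}-b,\qquad i=1,\ldots,n-1.\qquad(\ast)$$ (2) The user-optimal equilibrium is any feasible partition solving $$\min_{\substack{\underline w=t_0<\cdots<t_n=\bar w\\ n\le N_{\max}}}\ \sum_{i=1}^n p(t_{i-1},t_i)\left(\Psi(t_{i-1},t_i)-\Phi(t_{i-1},t_i)^2\right)\quad\text{subject to }(\ast).$$ (3) If $t_0<\cdots<t_n$ is such a user-optimal partition and $w_\ell^*(D)\in[t_{i-1},t_i]$, then the user-optimal dataset report is $M^*(D)=[t_{i-1},t_i]$.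
   Context: Game. A user holds a private dataset $D$; the only payoff-relevant information in it is the learner-optimal parameter $w_\ell^*(D)\in\mathcal W=[\underline w,\bar w]\subseteq\mathbb R$, distributed according to a commonly known prior $\pi_w$ ("continuous" means atomless). The user observes $w_\ell^*(D)$ and sends a costless, unverifiable report; the learner observes only the report and chooses a deployed parameter $w\in\mathcal W$. Utilities are $U^\ell(D,w)=-|w-w_\ell^*(D)|^2$ (learner) and $U^r(D,w)=-|w-(w_\ell^*(D)+b)|^2$ (user). In equilibrium the learner maximizes its expected utility given the Bayes posterior, i.e. responds with the posterior mean of $w_\ell^*(D)$, and at every value of $w_\ell^*(D)$ the user's report maximizes the user's utility given the learner's responses. Reports that result in the same learner response are identified, and equilibria are represented by ordered interval partitions. A partition $\underline w=t_0<\cdots<t_n=\bar w$ is identified with the strategy profile in which the user reports the interval $[t_{i-1},t_i]$ containing $w_\ell^*(D)$ (ties at cutpoints broken arbitrarily), and the learner responds to the report $[t_{i-1},t_i]$ with $\Phi(t_{i-1},t_i)$; it is a feasible equilibrium when no value of $w_\ell^*(D)$ strictly prefers to send the report of another interval of the partition. A user-optimal equilibrium is a feasible equilibrium maximizing the user's ex ante expected utility $\mathbb E_{\pi_w}[U^r]$. Notation, for $\underline w\le s<t\le\bar w$: $p(s,t)=\Pr_{\pi_w}(w_\ell^*(D)\in[s,t])$, $\Phi(s,t)=\mathbb E_{\pi_w}[w_\ell^*(D)\mid w_\ell^*(D)\in[s,t]]$, $\Psi(s,t)=\mathbb E_{\pi_w}[w_\ell^*(D)^2\mid w_\ell^*(D)\in[s,t]]$.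 *)

theory Defs
  imports "HOL-Probability.Probability"
begin

text \<open>
  Datasets are the points of a probability space \<open>M\<close>, and \<open>wstar D\<close> is the learner-optimal parameter
  of the dataset \<open>D\<close>. The prior on \<open>wstar D\<close> is the induced law on the real line.
\<close>

definition prior :: "'d measure \<Rightarrow> ('d \<Rightarrow> real) \<Rightarrow> real measure" where
  "prior M wstar = distr M borel wstar"

definition atomless :: "real measure \<Rightarrow> bool" where
  "atomless \<pi> \<longleftrightarrow> (\<forall>x. measure \<pi> {x} = 0)"

definition topological_support :: "real measure \<Rightarrow> real set" where
  "topological_support \<pi> = {x. \<forall>U. open U \<and> x \<in> U \<longrightarrow> measure \<pi> U > 0}"

definition user_utility :: "('d \<Rightarrow> real) \<Rightarrow> real \<Rightarrow> 'd \<Rightarrow> real \<Rightarrow> real" where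
  "user_utility wstar b D w = - (\<bar>w - (wstar D + b)\<bar>\<^sup>2)"

text \<open>\<open>uniform_measure \<pi> R\<close> is \<open>\<pi>\<close> conditioned on the event \<open>R\<close>.\<close>

definition posterior_mean :: "real measure \<Rightarrow> real set \<Rightarrow> real" where
  "posterior_mean \<pi> R = (\<integral>x. x \<partial>uniform_measure \<pi> R)"

definition interval_prob :: "real measure \<Rightarrow> real \<Rightarrow> real \<Rightarrow> real" where
  "interval_prob \<pi> s t = measure \<pi> {s..t}"

definition Phi :: "real measure \<Rightarrow> real \<Rightarrow> real \<Rightarrow> real" where
  "Phi \<pi> s t = posterior_mean \<pi> {s..t}"

definition Psi :: "real measure \<Rightarrow> real \<Rightarrow> real \<Rightarrow> real" where
  "Psi \<pi> s t = (\<integral>x. x\<^sup>2 \<partial>uniform_measure \<pi> {s..t})"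

text \<open>
  A partition is given by \<open>n\<close> and the values \<open>t 0, \<dots>, t n\<close>; the values of \<open>t\<close> beyond \<open>n\<close> are irrelevant.
  Its \<open>i\<close>-th interval, for \<open>1 \<le> i \<le> n\<close>, is \<open>{t (i - 1)..t i}\<close>.
\<close>

definition interval_partition :: "real \<Rightarrow> real \<Rightarrow> nat \<Rightarrow> (nat \<Rightarrow> real) \<Rightarrow> bool" where
  "interval_partition wlo whi n t \<longleftrightarrow> t 0 = wlo \<and> t n = whi \<and> (\<forall>i<n. t i < t (Suc i))"

definition reports :: "nat \<Rightarrow> (nat \<Rightarrow> real) \<Rightarrow> real set set" where
  "reports n t = {{t (i - 1)..t i} | i. i \<in> {1..n}}"

text \<open>
  The learner answers a report \<open>R\<close> with the posterior mean given that the parameter lies in \<open>R\<close>. The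
  reports that are optimal for the user with dataset \<open>D\<close> against this response:
\<close>

definition optimal_reports ::
  "'d measure \<Rightarrow> ('d \<Rightarrow> real) \<Rightarrow> real \<Rightarrow> nat \<Rightarrow> (nat \<Rightarrow> real) \<Rightarrow> 'd \<Rightarrow> real set set" where
  "optimal_reports M wstar b n t D =
    {R \<in> reports n t. \<forall>R' \<in> reports n t.
       user_utility wstar b D (posterior_mean (prior M wstar) R')
         \<le> user_utility wstar b D (posterior_mean (prior M wstar) R)}"

text \<open>
  At a cutpoint both adjacent intervals contain the parameter and both must be optimal, so the
  condition does not depend on how ties are broken.
\<close>

definition feasible_equilibrium ::
  "'d measure \<Rightarrow> ('d \<Rightarrow> real) \<Rightarrow> real \<Rightarrow> real \<Rightarrow> real \<Rightarrow> nat \<Rightarrow> (nat \<Rightarrow> real) \<Rightarrow> bool" where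
  "feasible_equilibrium M wstar wlo whi b n t \<longleftrightarrow>
    interval_partition wlo whi n t \<and>
    (\<forall>D \<in> space M. \<forall>R \<in> reports n t. wstar D \<in> R \<longrightarrow> R \<in> optimal_reports M wstar b n t D)"

text \<open>
  The user's strategies belonging to a partition; they differ only in how ties at cutpoints are broken.
  Measurability is needed for the expected utility to be meaningful.
\<close>

definition reporting_strategy ::
  "'d measure \<Rightarrow> ('d \<Rightarrow> real) \<Rightarrow> nat \<Rightarrow> (nat \<Rightarrow> real) \<Rightarrow> ('d \<Rightarrow> real set) \<Rightarrow> bool" where
  "reporting_strategy M wstar n t m \<longleftrightarrow>
    m \<in> measurable M (count_space UNIV) \<and>
    (\<forall>D \<in> space M. m D \<in> reports n t \<and> wstar D \<in> m D)"

definition ex_ante_user_utility ::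
  "'d measure \<Rightarrow> ('d \<Rightarrow> real) \<Rightarrow> real \<Rightarrow> ('d \<Rightarrow> real set) \<Rightarrow> real" where
  "ex_ante_user_utility M wstar b m =
    (\<integral>D. user_utility wstar b D (posterior_mean (prior M wstar) (m D)) \<partial>M)"

definition user_optimal_equilibrium ::
  "'d measure \<Rightarrow> ('d \<Rightarrow> real) \<Rightarrow> real \<Rightarrow> real \<Rightarrow> real \<Rightarrow> nat \<Rightarrow> (nat \<Rightarrow> real) \<Rightarrow> bool" where
  "user_optimal_equilibrium M wstar wlo whi b n t \<longleftrightarrow>
    feasible_equilibrium M wstar wlo whi b n t \<and>
    (\<forall>n' t' m m'. feasible_equilibrium M wstar wlo whi b n' t' \<and>
       reporting_strategy M wstar n t m \<and> reporting_strategy M wstar n' t' m' \<longrightarrow>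
       ex_ante_user_utility M wstar b m' \<le> ex_ante_user_utility M wstar b m)"

definition Nmax :: "real \<Rightarrow> real \<Rightarrow> real \<Rightarrow> int" where
  "Nmax wlo whi b = \<lfloor>1 + (whi - wlo) / (2 * b)\<rfloor>"

definition cutpoint_condition :: "real measure \<Rightarrow> real \<Rightarrow> nat \<Rightarrow> (nat \<Rightarrow> real) \<Rightarrow> bool" where
  "cutpoint_condition \<pi> b n t \<longleftrightarrow>
    (\<forall>i \<in> {1..<n}. t i = (Phi \<pi> (t (i - 1)) (t i) + Phi \<pi> (t i) (t (i + 1))) / 2 - b)"

definition partition_loss :: "real measure \<Rightarrow> nat \<Rightarrow> (nat \<Rightarrow> real) \<Rightarrow> real" where
  "partition_loss \<pi> n t =
    (\<Sum>i = 1..n. interval_prob \<pi> (t (i - 1)) (t i) *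
       (Psi \<pi> (t (i - 1)) (t i) - (Phi \<pi> (t (i - 1)) (t i))\<^sup>2))"

end

theory Submission
  imports Defs
begin

text \<open>
  Quadratic loss makes the user with parameter \<open>x\<close> pick the response nearest to \<open>x + b\<close>. As the responses
  are increasing in the cell, each cell is optimal exactly for its own members iff every \<open>t i + b\<close> is the
  midpoint of the two adjacent responses. A response lies strictly inside its cell, so the midpoint
  condition forces \<open>t (i + 1) - t i > 2 * b\<close> for \<open>i \<ge> 1\<close>, which bounds the number of cells. Finally, the
  posterior mean is unbiased on each cell, so the bias costs the user the constant \<open>b\<^sup>2\<close> in every partition
  and the ex ante utility is \<open>- partition_loss - b\<^sup>2\<close>.
\<close>

section \<open>Partitions and nearest responses\<close>

lemma interval_partition_mono:
  assumes "interval_partition wlo whi n t" "i \<le> j" "j \<le> n"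
  shows "t i \<le> t j"
  using assms(2,3)
proof (induction j rule: dec_induct)
  case (step k)
  then have "t k < t (Suc k)"
    using assms(1) by (auto simp: interval_partition_def)
  with step show ?case by auto
qed simp

lemma interval_partition_cell:
  assumes "interval_partition wlo whi n t" "i \<in> {1..n}"
  shows "wlo \<le> t (i - 1)" "t (i - 1) < t i" "t i \<le> whi"
proof -
  have "i - 1 < n" "Suc (i - 1) = i" using assms(2) by auto
  then show "t (i - 1) < t i"
    using assms(1) unfolding interval_partition_def by metis
  have "t 0 = wlo" "t n = whi"
    using assms(1) by (auto simp: interval_partition_def)
  then show "wlo \<le> t (i - 1)" "t i \<le> whi"
    using interval_partition_mono[OF assms(1), of 0 "i - 1"]
      interval_partition_mono[OF assms(1), of i n] assms(2) by auto
qed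

text \<open>The difference of the two squares factors as \<open>(v - u) * (u + v - 2 * y)\<close>,
  so the comparison only depends on the side of the midpoint on which \<open>y\<close> lies.\<close>

lemma nearer_response:
  fixes u v y :: real
  assumes "u \<le> v" "2 * y \<le> u + v"
  shows "(u - y)\<^sup>2 \<le> (v - y)\<^sup>2"
proof -
  have "0 \<le> (v - u) * (u + v - 2 * y)" using assms by simp
  then show ?thesis by (simp add: power2_eq_square algebra_simps)
qed

lemma strictly_nearer_response:
  fixes u v y :: real
  assumes "u < v" "2 * y < u + v"
  shows "(u - y)\<^sup>2 < (v - y)\<^sup>2"
proof -
  have "0 < (v - u) * (u + v - 2 * y)" using assms by simp
  then show ?thesis by (simp add: power2_eq_square algebra_simps)
qed

text \<open>Isolates the order-theoretic core from the prior: \<phi> \<open>i\<close> stands for the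
  response to cell \<open>i\<close>, and only its position inside the cell and the midpoint
  condition matter.\<close>

locale interlaced_responses =
  fixes wlo whi b :: real and n :: nat and t \<phi> :: "nat \<Rightarrow> real"
  assumes partition: "interval_partition wlo whi n t"
    and inside: "i \<in> {1..n} \<Longrightarrow> t (i - 1) < \<phi> i \<and> \<phi> i < t i"
    and midpoint: "i \<in> {1..<n} \<Longrightarrow> 2 * (t i + b) = \<phi> i + \<phi> (i + 1)"
begin

lemma responses_increasing:
  assumes "i < j" "i \<in> {1..n}" "j \<in> {1..n}"
  shows "\<phi> i < \<phi> j"
proof -
  have "t i \<le> t (j - 1)"
    using interval_partition_mono[OF partition, of i "j - 1"] assms by auto
  then show ?thesis using inside[of i] inside[of j] assms by auto
qed

text \<open>Extends the midpoint condition from adjacent to arbitrary pairs of cells by monotonicity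
  of \<phi>. In the strict versions, strictness comes from \<open>x\<close> when the cells are
  adjacent and from \<phi> otherwise.\<close>

lemma midpoint_above:
  assumes "i < j" "i \<in> {1..n}" "j \<in> {1..n}"
  shows "2 * (t i + b) \<le> \<phi> i + \<phi> j" and "2 * (t (j - 1) + b) \<ge> \<phi> i + \<phi> j"
    and "x < t (j - 1) \<Longrightarrow> x \<le> t i \<Longrightarrow> 2 * (x + b) < \<phi> i + \<phi> j"
    and "x > t i \<Longrightarrow> x \<ge> t (j - 1) \<Longrightarrow> 2 * (x + b) > \<phi> i + \<phi> j"
proof -
  have lower: "2 * (t i + b) = \<phi> i + \<phi> (i + 1)"
    using midpoint[of i] assms by auto
  have upper: "2 * (t (j - 1) + b) = \<phi> (j - 1) + \<phi> j"
    using midpoint[of "j - 1"] assms by force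
  have adjacent_or: "j = i + 1 \<or> (\<phi> (i + 1) < \<phi> j \<and> \<phi> i < \<phi> (j - 1))"
    using responses_increasing[of "i + 1" j] responses_increasing[of i "j - 1"] assms by force
  show "2 * (t i + b) \<le> \<phi> i + \<phi> j" "2 * (t (j - 1) + b) \<ge> \<phi> i + \<phi> j"
    using lower upper adjacent_or by auto
  show "2 * (x + b) < \<phi> i + \<phi> j" if "x < t (j - 1)" "x \<le> t i"
    using lower adjacent_or that by auto
  show "2 * (x + b) > \<phi> i + \<phi> j" if "x > t i" "x \<ge> t (j - 1)"
    using upper adjacent_or that by auto
qed

lemma own_cell_nearest:
  assumes "i \<in> {1..n}" "j \<in> {1..n}" "x \<in> {t (i - 1)..t i}"
  shows "(\<phi> i - (x + b))\<^sup>2 \<le> (\<phi> j - (x + b))\<^sup>2"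
proof -
  consider "i < j" | "i = j" | "j < i" by linarith
  then show ?thesis
  proof cases
    case 1
    then show ?thesis
      using midpoint_above(1)[of i j] responses_increasing[of i j] assms
      by (intro nearer_response) auto
  next
    case 3
    \<comment> \<open>Reflection at 0 reverses the order of the responses, so the same one-sided
      comparison applies.\<close>
    then have "(- \<phi> i - (- (x + b)))\<^sup>2 \<le> (- \<phi> j - (- (x + b)))\<^sup>2"
      using midpoint_above(2)[of j i] responses_increasing[of j i] assms
      by (intro nearer_response) auto
    then show ?thesis by (simp add: power2_eq_square algebra_simps)
  qed simp
qed

text \<open>A point of cell \<open>i\<close> outside cell \<open>j\<close> lies strictly beyond the
  endpoint of cell \<open>j\<close> that faces cell \<open>i\<close>, which triggers the strict
  midpoint bounds. This confines ties between reports to cutpoints.\<close>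

lemma other_cell_worse:
  assumes "i \<in> {1..n}" "j \<in> {1..n}" "x \<in> {t (i - 1)..t i}" "x \<notin> {t (j - 1)..t j}"
  shows "(\<phi> i - (x + b))\<^sup>2 < (\<phi> j - (x + b))\<^sup>2"
proof -
  consider "i < j" | "i = j" | "j < i" by linarith
  then show ?thesis
  proof cases
    case 1
    then have "t i \<le> t j"
      using interval_partition_mono[OF partition, of i j] assms by auto
    then show ?thesis
      using 1 midpoint_above(3)[of i j x] responses_increasing[of i j] assms
      by (intro strictly_nearer_response) auto
  next
    case 3
    then have "t (j - 1) \<le> t (i - 1)"
      using interval_partition_mono[OF partition, of "j - 1" "i - 1"] assms by auto
    then have "(- \<phi> i - (- (x + b)))\<^sup>2 < (- \<phi> j - (- (x + b)))\<^sup>2"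
      using 3 midpoint_above(4)[of j i x] responses_increasing[of j i] assms
      by (intro strictly_nearer_response) auto
    then show ?thesis by (simp add: power2_eq_square algebra_simps)
  qed (use assms in auto)
qed

text \<open>Adding \<phi> \<open>k < t k\<close> and \<phi> \<open>(k + 1) < t (k + 1)\<close> turns
  the midpoint condition into \<open>t (k + 1) - t k > 2 * b\<close>. The first cell is only known
  to have positive length, hence the factor \<open>real k - 1\<close>.\<close>

lemma cutpoints_spread:
  assumes "1 \<le> k" "k \<le> n"
  shows "t k - t 0 > 2 * b * (real k - 1)"
  using assms
proof (induction k rule: dec_induct)
  case base
  then show ?case using inside[of 1] by auto
next
  case (step k)
  have "t (Suc k) - t k > 2 * b"
    using midpoint[of k] inside[of k] inside[of "Suc k"] step by auto
  with step show ?case by (auto simp: algebra_simps)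
qed

end

section \<open>Moments of the prior on a cell\<close>

locale communication_game = prob_space M
  for M :: "'d measure" and wstar :: "'d \<Rightarrow> real" and wlo whi b :: real +
  assumes wstar_measurable [measurable]: "wstar \<in> borel_measurable M"
    and wstar_range: "D \<in> space M \<Longrightarrow> wstar D \<in> {wlo..whi}"
    and atomless: "atomless (prior M wstar)"
    and full_support: "topological_support (prior M wstar) = {wlo..whi}"
    and bias_pos: "b > 0"
begin

abbreviation (input) "\<pi> \<equiv> prior M wstar"

sublocale prior: real_distribution \<pi>
  unfolding prior_def using real_distribution_distr by simp

lemma prior_singleton: "AE x in \<pi>. x \<noteq> a"
proof -
  have "emeasure \<pi> {a} = 0"
    using atomless by (simp add: atomless_def prior.emeasure_eq_measure)
  then show ?thesis
    by (intro AE_I[where N = "{a}"]) auto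
qed

lemma wstar_neq: "AE D in M. wstar D \<noteq> a"
  using prior_singleton[of a] unfolding prior_def
  by (subst (asm) AE_distr_iff) auto

text \<open>Otherwise \<open>wstar\<close> would be constant and the prior would have an
  atom.\<close>

lemma wlo_less_whi: "wlo < whi"
proof (rule ccontr)
  assume "\<not> wlo < whi"
  then have "AE D in M. wstar D = wlo"
    using wstar_range by (force intro!: AE_I2)
  with wstar_neq[of wlo] have "AE D in M. False"
    by eventually_elim simp
  then show False by simp
qed

lemma interval_prob_pos:
  assumes "wlo \<le> s" "s < t" "t \<le> whi"
  shows "measure \<pi> {s<..<t} > 0" "measure \<pi> {s..t} > 0"
proof -
  \<comment> \<open>The open interval is a neighbourhood of its midpoint, which is a support
    point.\<close>
  have "(s + t) / 2 \<in> topological_support \<pi>"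
    using assms by (auto simp: full_support)
  then show *: "measure \<pi> {s<..<t} > 0"
    using assms unfolding topological_support_def by auto
  have "measure \<pi> {s<..<t} \<le> measure \<pi> {s..t}"
    by (intro prior.finite_measure_mono) auto
  with * show "measure \<pi> {s..t} > 0" by simp
qed

text \<open>An open interval missed by \<open>wstar\<close> would have prior measure zero.\<close>

lemma wstar_dense:
  assumes "wlo \<le> s" "s < t" "t \<le> whi"
  obtains D where "D \<in> space M" "s < wstar D" "wstar D < t"
proof (rule ccontr)
  assume "\<not> thesis"
  then have "wstar -` {s<..<t} \<inter> space M = {}"
    using that by auto
  then have "measure \<pi> {s<..<t} = 0"
    unfolding prior_def by (simp add: measure_distr)
  with interval_prob_pos[OF assms] show False by simp
qed

lemma prob_space_cell:
  assumes "wlo \<le> s" "s < t" "t \<le> whi"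
  shows "prob_space (uniform_measure \<pi> {s..t})"
  using interval_prob_pos[OF assms]
  by (intro prob_space_uniform_measure) (auto simp: prior.emeasure_eq_measure)

lemma integrable_cell:
  assumes "wlo \<le> s" "s < t" "t \<le> whi"
  shows "integrable (uniform_measure \<pi> {s..t}) (\<lambda>x. x ^ k)"
    and "integrable \<pi> (\<lambda>x. indicator {s..t} x * x ^ k)"
proof -
  have bound: "\<bar>x ^ k\<bar> \<le> max \<bar>s\<bar> \<bar>t\<bar> ^ k" if "x \<in> {s..t}" for x :: real
    unfolding power_abs using that by (intro power_mono) auto
  interpret cell: prob_space "uniform_measure \<pi> {s..t}"
    by (rule prob_space_cell[OF assms])
  show "integrable (uniform_measure \<pi> {s..t}) (\<lambda>x. x ^ k)"
    using bound
    by (intro cell.integrable_const_bound[where B = "max \<bar>s\<bar> \<bar>t\<bar> ^ k"] AE_uniform_measureI) auto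
  show "integrable \<pi> (\<lambda>x. indicator {s..t} x * x ^ k)"
    using bound
    by (intro prior.integrable_const_bound[where B = "max \<bar>s\<bar> \<bar>t\<bar> ^ k"])
      (auto split: split_indicator)
qed

lemma integral_cell:
  fixes f :: "real \<Rightarrow> real"
  assumes "wlo \<le> s" "s < t" "t \<le> whi" and [measurable]: "f \<in> borel_measurable borel"
  shows "(\<integral>x. indicator {s..t} x * f x \<partial>\<pi>) =
    interval_prob \<pi> s t * (\<integral>x. f x \<partial>uniform_measure \<pi> {s..t})"
proof -
  have pos: "measure \<pi> {s..t} > 0"
    using interval_prob_pos[OF assms(1-3)] by simp
  \<comment> \<open>Rewrites the extended-real quotient as a real density, the form that
    \<open>integral_density\<close> accepts.\<close>
  have "uniform_measure \<pi> {s..t} =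
      density \<pi> (\<lambda>x. ennreal (indicator {s..t} x / measure \<pi> {s..t}))"
    unfolding uniform_measure_def
    using pos by (intro density_cong)
      (auto simp: prior.emeasure_eq_measure divide_ennreal ennreal_1[symmetric]
        simp del: ennreal_1 split: split_indicator)
  then have "(\<integral>x. f x \<partial>uniform_measure \<pi> {s..t}) =
      (\<integral>x. (indicator {s..t} x / measure \<pi> {s..t}) * f x \<partial>\<pi>)"
    by (simp add: integral_density)
  also have "\<dots> = (\<integral>x. indicator {s..t} x * f x \<partial>\<pi>) / measure \<pi> {s..t}"
    by simp
  finally show ?thesis
    using pos by (simp add: interval_prob_def)
qed

text \<open>Both endpoints are null, so the conditioned parameter lies strictly between them almost
  surely, and so does its mean.\<close>

lemma Phi_inside:
  assumes "wlo \<le> s" "s < t" "t \<le> whi"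
  shows "s < Phi \<pi> s t" "Phi \<pi> s t < t"
proof -
  interpret cell: prob_space "uniform_measure \<pi> {s..t}"
    by (rule prob_space_cell[OF assms])
  have int: "integrable (uniform_measure \<pi> {s..t}) (\<lambda>x. x)"
    using integrable_cell(1)[OF assms, of 1] by simp
  have "AE x in uniform_measure \<pi> {s..t}. s < x" "AE x in uniform_measure \<pi> {s..t}. x < t"
    using prior_singleton[of s] prior_singleton[of t]
    by (auto intro!: AE_uniform_measureI)
  then show "s < Phi \<pi> s t" "Phi \<pi> s t < t"
    using cell.expectation_greater[OF int] cell.expectation_less[OF int]
    by (auto simp: Phi_def posterior_mean_def)
qed

text \<open>Bias-variance decomposition on one cell: the cross term vanishes because the response is
  the conditional mean.\<close>

lemma cell_loss:
  assumes "wlo \<le> s" "s < t" "t \<le> whi"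
  defines "g \<equiv> \<lambda>x. (Phi \<pi> s t - (x + b))\<^sup>2"
  shows "integrable \<pi> (\<lambda>x. indicator {s..t} x * g x)"
    and "(\<integral>x. indicator {s..t} x * g x \<partial>\<pi>) =
      interval_prob \<pi> s t * (Psi \<pi> s t - (Phi \<pi> s t)\<^sup>2) + b\<^sup>2 * interval_prob \<pi> s t"
proof -
  define c where "c = Phi \<pi> s t - b"
  define I where "I k x = indicator {s..t} x * x ^ k" for k and x :: real
  \<comment> \<open>Expanding around \<open>c\<close> leaves only the truncated moments of order 0,
    1 and 2.\<close>
  have g_eq: "indicator {s..t} x * g x = c\<^sup>2 * I 0 x - 2 * c * I 1 x + I 2 x" for x
    by (simp add: g_def c_def I_def power2_eq_square algebra_simps split: split_indicator)
  have int: "integrable \<pi> (I k)" for k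
    unfolding I_def by (rule integrable_cell(2)[OF assms(1-3)])
  show "integrable \<pi> (\<lambda>x. indicator {s..t} x * g x)"
    unfolding g_eq using int by simp
  have "(\<integral>x. indicator {s..t} x * g x \<partial>\<pi>) =
      c\<^sup>2 * (\<integral>x. I 0 x \<partial>\<pi>) - 2 * c * (\<integral>x. I 1 x \<partial>\<pi>) + (\<integral>x. I 2 x \<partial>\<pi>)"
    unfolding g_eq using int by simp
  also have "(\<integral>x. I 0 x \<partial>\<pi>) = interval_prob \<pi> s t"
    by (simp add: I_def interval_prob_def)
  also have "(\<integral>x. I 1 x \<partial>\<pi>) = interval_prob \<pi> s t * Phi \<pi> s t"
    using integral_cell[OF assms(1-3), of "\<lambda>x. x"] by (simp add: I_def Phi_def posterior_mean_def)
  also have "(\<integral>x. I 2 x \<partial>\<pi>) = interval_prob \<pi> s t * Psi \<pi> s t"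
    using integral_cell[OF assms(1-3), of "\<lambda>x. x ^ 2"] by (simp add: I_def Psi_def)
  finally show "(\<integral>x. indicator {s..t} x * g x \<partial>\<pi>) =
      interval_prob \<pi> s t * (Psi \<pi> s t - (Phi \<pi> s t)\<^sup>2) + b\<^sup>2 * interval_prob \<pi> s t"
    by (simp add: c_def power2_eq_square algebra_simps)
qed

section \<open>Feasible equilibria\<close>

lemma user_utility_cell:
  "user_utility wstar b D (posterior_mean \<pi> {s..t}) = - ((Phi \<pi> s t - (wstar D + b))\<^sup>2)"
  by (simp add: user_utility_def Phi_def)

lemma reportsI: "i \<in> {1..n} \<Longrightarrow> {t (i - 1)..t i} \<in> reports n t"
  by (auto simp: reports_def)

lemma partition_nonempty:
  assumes "interval_partition wlo whi n t"
  shows "n \<ge> 1"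
  using assms wlo_less_whi by (cases n) (auto simp: interval_partition_def)

lemma interlaced:
  assumes "interval_partition wlo whi n t" "cutpoint_condition \<pi> b n t"
  shows "interlaced_responses wlo whi b n t (\<lambda>i. Phi \<pi> (t (i - 1)) (t i))"
proof
  show "interval_partition wlo whi n t" by fact
  show "t (i - 1) < Phi \<pi> (t (i - 1)) (t i) \<and> Phi \<pi> (t (i - 1)) (t i) < t i"
    if "i \<in> {1..n}" for i
    using Phi_inside interval_partition_cell[OF assms(1) that] by blast
  show "2 * (t i + b) = Phi \<pi> (t (i - 1)) (t i) + Phi \<pi> (t (i + 1 - 1)) (t (i + 1))"
    if "i \<in> {1..<n}" for i
    using assms(2) that by (auto simp: cutpoint_condition_def field_simps)
qed

text \<open>The first claim gives feasibility. The second shows that the optimal report is unique up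
  to ties: every optimal report also contains the true parameter.\<close>

lemma cutpoint_optimal_reports:
  assumes part: "interval_partition wlo whi n t" and cut: "cutpoint_condition \<pi> b n t"
    and D: "D \<in> space M" and i: "i \<in> {1..n}" "wstar D \<in> {t (i - 1)..t i}"
  shows "{t (i - 1)..t i} \<in> optimal_reports M wstar b n t D"
    and "R \<in> optimal_reports M wstar b n t D \<Longrightarrow> wstar D \<in> R"
proof -
  interpret interlaced_responses wlo whi b n t "\<lambda>i. Phi \<pi> (t (i - 1)) (t i)"
    by (rule interlaced[OF part cut])
  show "{t (i - 1)..t i} \<in> optimal_reports M wstar b n t D"
    using own_cell_nearest[OF i(1) _ i(2)] reportsI[OF i(1), of t]
    by (auto simp: optimal_reports_def reports_def user_utility_cell)
  show "wstar D \<in> R" if R: "R \<in> optimal_reports M wstar b n t D"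
  proof (rule ccontr)
    assume notin: "wstar D \<notin> R"
    obtain j where j: "j \<in> {1..n}" "R = {t (j - 1)..t j}"
      using R by (auto simp: optimal_reports_def reports_def)
    have "user_utility wstar b D (posterior_mean \<pi> {t (i - 1)..t i}) \<le>
        user_utility wstar b D (posterior_mean \<pi> R)"
      using R reportsI[OF i(1), of t] by (auto simp: optimal_reports_def)
    with other_cell_worse[OF i(1) j(1) i(2)] notin j(2) show False
      by (simp add: user_utility_cell)
  qed
qed

lemma cutpoint_condition_imp_feasible:
  assumes "interval_partition wlo whi n t" "cutpoint_condition \<pi> b n t"
  shows "feasible_equilibrium M wstar wlo whi b n t"
  using assms cutpoint_optimal_reports(1)[OF assms]
  by (auto simp: feasible_equilibrium_def reports_def)

text \<open>
  The range of \<open>wstar\<close> need not contain the cutpoints, but it is dense, so indifference at a cutpoint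
  follows by approaching it from both sides.
\<close>

lemma feasible_imp_cutpoint_condition:
  assumes feas: "feasible_equilibrium M wstar wlo whi b n t"
  shows "cutpoint_condition \<pi> b n t"
  unfolding cutpoint_condition_def
proof
  fix i assume i: "i \<in> {1..<n}"
  have part: "interval_partition wlo whi n t"
    using feas by (simp add: feasible_equilibrium_def)
  have mem: "i \<in> {1..n}" "Suc i \<in> {1..n}" using i by auto
  note cell = interval_partition_cell[OF part mem(1)]
  note cell' = interval_partition_cell[OF part mem(2), simplified]
  define u v where "u = Phi \<pi> (t (i - 1)) (t i)" and "v = Phi \<pi> (t i) (t (Suc i))"
  have uv: "u < v"
    using Phi_inside(2)[OF cell] Phi_inside(1)[OF cell'] by (simp add: u_def v_def)
  have reports: "{t (i - 1)..t i} \<in> reports n t" "{t i..t (Suc i)} \<in> reports n t"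
    using reportsI[OF mem(1), of t] reportsI[OF mem(2), of t] by auto
  have opt: "user_utility wstar b D (posterior_mean \<pi> R') \<le> user_utility wstar b D (posterior_mean \<pi> R)"
    if "D \<in> space M" "R \<in> reports n t" "R' \<in> reports n t" "wstar D \<in> R" for D R R'
    using feas that by (auto simp: feasible_equilibrium_def optimal_reports_def)
  \<comment> \<open>As \<open>u < v\<close>, each preference between the two reports becomes a
    linear inequality in \<open>y\<close>.\<close>
  have sq: "(v - y)\<^sup>2 - (u - y)\<^sup>2 = (v - u) * (u + v - 2 * y)" for y
    by (simp add: power2_eq_square algebra_simps)
  have "t i \<le> (u + v) / 2 - b"
  proof (rule dense_le_bounded[OF cell(2)])
    fix s assume s: "t (i - 1) < s" "s < t i"
    obtain D where D: "D \<in> space M" "s < wstar D" "wstar D < t i"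
      using wstar_dense[of s "t i"] s cell by auto
    have "(u - (wstar D + b))\<^sup>2 \<le> (v - (wstar D + b))\<^sup>2"
      using opt[OF D(1) reports] s D by (auto simp: user_utility_cell u_def v_def)
    then have "0 \<le> (v - u) * (u + v - 2 * (wstar D + b))"
      using sq[of "wstar D + b"] by linarith
    then have "0 \<le> u + v - 2 * (wstar D + b)"
      using uv by (simp add: zero_le_mult_iff)
    with D show "s \<le> (u + v) / 2 - b" by (simp add: field_simps)
  qed
  moreover have "(u + v) / 2 - b \<le> t i"
  proof (rule dense_ge_bounded[OF cell'(2)])
    fix s assume s: "t i < s" "s < t (Suc i)"
    obtain D where D: "D \<in> space M" "t i < wstar D" "wstar D < s"
      using wstar_dense[of "t i" s] s cell' by auto
    have "(v - (wstar D + b))\<^sup>2 \<le> (u - (wstar D + b))\<^sup>2"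
      using opt[OF D(1) reports(2,1)] s D by (auto simp: user_utility_cell u_def v_def)
    then have "(v - u) * (u + v - 2 * (wstar D + b)) \<le> 0"
      using sq[of "wstar D + b"] by linarith
    then have "u + v - 2 * (wstar D + b) \<le> 0"
      using uv by (simp add: mult_le_0_iff)
    with D show "(u + v) / 2 - b \<le> s" by (simp add: field_simps)
  qed
  ultimately show "t i = (Phi \<pi> (t (i - 1)) (t i) + Phi \<pi> (t i) (t (i + 1))) / 2 - b"
    by (simp add: u_def v_def)
qed

text \<open>The spread of the cutpoints up to \<open>k = n\<close> must fit into
  \<open>whi - wlo\<close>.\<close>

lemma cutpoint_condition_imp_le_Nmax:
  assumes part: "interval_partition wlo whi n t" and cut: "cutpoint_condition \<pi> b n t"
  shows "int n \<le> Nmax wlo whi b"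
proof -
  interpret interlaced_responses wlo whi b n t "\<lambda>i. Phi \<pi> (t (i - 1)) (t i)"
    by (rule interlaced[OF part cut])
  have "whi - wlo > 2 * b * (real n - 1)"
    using cutpoints_spread[OF partition_nonempty[OF part]] part
    by (simp add: interval_partition_def)
  then have "real n \<le> 1 + (whi - wlo) / (2 * b)"
    using bias_pos by (simp add: field_simps)
  then show ?thesis
    unfolding Nmax_def by (subst le_floor_iff) simp
qed

lemma feasible_iff:
  "feasible_equilibrium M wstar wlo whi b n t \<longleftrightarrow>
    interval_partition wlo whi n t \<and> int n \<le> Nmax wlo whi b \<and> cutpoint_condition \<pi> b n t"
  using cutpoint_condition_imp_feasible feasible_imp_cutpoint_condition
    cutpoint_condition_imp_le_Nmax feasible_equilibrium_def by blast

section \<open>Ex ante utility\<close>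

text \<open>Ensures that the quantification over strategies in
  \<open>user_optimal_equilibrium\<close> is not vacuous.\<close>

lemma reporting_strategy_exists:
  assumes part: "interval_partition wlo whi n t"
  obtains m where "reporting_strategy M wstar n t m"
proof
  \<comment> \<open>Interior ties go to the lower cell. The \<open>max 1\<close> covers
    \<open>wstar D = wlo\<close>, where the least index is 0 and no cell ends.\<close>
  define k where "k D = max 1 (LEAST i. wstar D \<le> t i)" for D
  have [measurable]: "k \<in> measurable M (count_space UNIV)"
    unfolding k_def by measurable
  have t0n: "t 0 = wlo" "t n = whi"
    using part by (auto simp: interval_partition_def)
  have "k D \<in> {1..n} \<and> wstar D \<in> {t (k D - 1)..t (k D)}" if D: "D \<in> space M" for D
  proof -
    define l where "l = (LEAST i. wstar D \<le> t i)"
    have "wstar D \<le> t n" using wstar_range[OF D] t0n by simp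
    then have l: "wstar D \<le> t l" "l \<le> n"
      unfolding l_def by (auto intro: LeastI Least_le)
    have before: "t i < wstar D" if "i < l" for i
      using not_less_Least[of i "\<lambda>i. wstar D \<le> t i"] that by (simp add: l_def)
    show ?thesis
    proof (cases "l = 0")
      case True
      then have "wstar D = t 0" using l wstar_range[OF D] t0n by simp
      moreover have "t 0 < t 1"
        using interval_partition_cell(2)[OF part, of 1] partition_nonempty[OF part] by simp
      ultimately show ?thesis
        using True partition_nonempty[OF part] by (simp add: k_def l_def[symmetric])
    next
      case False
      then show ?thesis
        using l before[of "l - 1"] by (auto simp: k_def l_def[symmetric])
    qed
  qed
  moreover have "(\<lambda>D. {t (k D - 1)..t (k D)}) \<in> measurable M (count_space UNIV)"
    by (rule measurable_compose[OF \<open>k \<in> _\<close>]) simp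
  ultimately show "reporting_strategy M wstar n t (\<lambda>D. {t (k D - 1)..t (k D)})"
    using reportsI by (simp add: reporting_strategy_def)
qed

text \<open>Ties occur only at the finitely many cutpoints, which are null, so they do not affect expectations.\<close>

lemma expectation_reporting_strategy:
  fixes g :: "real set \<Rightarrow> real \<Rightarrow> real"
  assumes part: "interval_partition wlo whi n t" and strat: "reporting_strategy M wstar n t m"
    and meas: "(\<lambda>D. g (m D) (wstar D)) \<in> borel_measurable M"
    and int: "\<And>i. i \<in> {1..n} \<Longrightarrow>
      integrable \<pi> (\<lambda>x. indicator {t (i - 1)..t i} x * g {t (i - 1)..t i} x)"
  shows "(\<integral>D. g (m D) (wstar D) \<partial>M) =
    (\<Sum>i = 1..n. \<integral>x. indicator {t (i - 1)..t i} x * g {t (i - 1)..t i} x \<partial>\<pi>)"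
proof -
  let ?h = "\<lambda>i x. indicator {t (i - 1)..t i} x * g {t (i - 1)..t i} x"
  have int_M: "integrable M (\<lambda>D. ?h i (wstar D))" if "i \<in> {1..n}" for i
    using integrable_distr[OF wstar_measurable int[OF that, unfolded prior_def]] .
  \<comment> \<open>Away from the cutpoints exactly one cell contains the parameter, so the sum
    below has at most one nonzero term.\<close>
  have "AE D in M. \<forall>i\<in>{..n}. wstar D \<noteq> t i"
    by (intro AE_finite_allI wstar_neq) simp
  then have ae: "AE D in M. g (m D) (wstar D) = (\<Sum>i = 1..n. ?h i (wstar D))"
    using AE_space
  proof eventually_elim
    case (elim D)
    obtain i where i: "i \<in> {1..n}" "m D = {t (i - 1)..t i}" "wstar D \<in> {t (i - 1)..t i}"
      using strat elim unfolding reporting_strategy_def reports_def by blast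
    have other: "?h j (wstar D) = 0" if j: "j \<in> {1..n}" "j \<noteq> i" for j
    proof (cases "i < j")
      case True
      then have "t i \<le> t (j - 1)"
        using interval_partition_mono[OF part, of i "j - 1"] j by auto
      moreover have "wstar D < t i" using i elim by (auto simp: less_le)
      ultimately show ?thesis by auto
    next
      case False
      then have "t j \<le> t (i - 1)"
        using interval_partition_mono[OF part, of j "i - 1"] i j by auto
      moreover have "wstar D \<noteq> t (i - 1)" using i elim(1) by auto
      ultimately show ?thesis using i by auto
    qed
    have "(\<Sum>j = 1..n. ?h j (wstar D)) = (\<Sum>j\<in>{i}. ?h j (wstar D))"
      using i other by (intro sum.mono_neutral_right) auto
    with i show ?case by simp
  qed
  have "(\<integral>D. g (m D) (wstar D) \<partial>M) = (\<integral>D. (\<Sum>i = 1..n. ?h i (wstar D)) \<partial>M)"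
    using meas ae borel_measurable_integrable[OF int_M]
    by (intro integral_cong_AE borel_measurable_sum) auto
  also have "\<dots> = (\<Sum>i = 1..n. \<integral>D. ?h i (wstar D) \<partial>M)"
    using int_M by (intro Bochner_Integration.integral_sum)
  also have "\<dots> = (\<Sum>i = 1..n. \<integral>x. ?h i x \<partial>\<pi>)"
    using borel_measurable_integrable[OF int] unfolding prior_def
    by (intro sum.cong refl integral_distr[symmetric]) auto
  finally show ?thesis .
qed

text \<open>Sums \<open>cell_loss\<close> over the cells. The right-hand side does not mention
  \<open>m\<close>, so tie-breaking does not affect the ex ante utility.\<close>

lemma ex_ante_user_utility_eq:
  assumes part: "interval_partition wlo whi n t" and strat: "reporting_strategy M wstar n t m"
  shows "ex_ante_user_utility M wstar b m = - partition_loss \<pi> n t - b\<^sup>2"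
proof -
  note cell = interval_partition_cell[OF part]
  have [measurable]: "m \<in> measurable M (count_space UNIV)"
    using strat by (simp add: reporting_strategy_def)
  have [measurable]: "(\<lambda>D. posterior_mean \<pi> (m D)) \<in> borel_measurable M"
    by (rule measurable_compose[OF \<open>m \<in> _\<close>]) simp
  \<comment> \<open>The constant function 1 shows that the cell probabilities add up to 1 although
    closed cells share cutpoints.\<close>
  have "(\<integral>D. wstar D ^ 0 \<partial>M) = (\<Sum>i = 1..n. \<integral>x. indicator {t (i - 1)..t i} x * x ^ 0 \<partial>\<pi>)"
    by (rule expectation_reporting_strategy[OF part strat, where g = "\<lambda>R x. x ^ 0"])
      (measurable, rule integrable_cell(2)[OF cell])
  then have total: "(\<Sum>i = 1..n. interval_prob \<pi> (t (i - 1)) (t i)) = 1"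
    by (simp add: interval_prob_def prob_space)
  have "ex_ante_user_utility M wstar b m =
      - (\<integral>D. (posterior_mean \<pi> (m D) - (wstar D + b))\<^sup>2 \<partial>M)"
    by (simp add: ex_ante_user_utility_def user_utility_def)
  also have "(\<integral>D. (posterior_mean \<pi> (m D) - (wstar D + b))\<^sup>2 \<partial>M) =
      (\<Sum>i = 1..n. \<integral>x. indicator {t (i - 1)..t i} x *
        (posterior_mean \<pi> {t (i - 1)..t i} - (x + b))\<^sup>2 \<partial>\<pi>)"
    using cell_loss(1)[OF cell]
    by (intro expectation_reporting_strategy[OF part strat,
          where g = "\<lambda>R x. (posterior_mean \<pi> R - (x + b))\<^sup>2"]) (auto simp: Phi_def)
  also have "\<dots> = partition_loss \<pi> n t + b\<^sup>2 * (\<Sum>i = 1..n. interval_prob \<pi> (t (i - 1)) (t i))"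
    using cell_loss(2)[OF cell]
    by (simp add: partition_loss_def Phi_def[symmetric] sum.distrib sum_distrib_left)
  finally show ?thesis
    unfolding total by simp
qed

text \<open>Utility and loss differ by a sign and the constant \<open>b\<^sup>2\<close>. Extracting
  a loss comparison from a utility comparison requires a strategy for each of the two
  partitions.\<close>

lemma user_optimal_iff:
  "user_optimal_equilibrium M wstar wlo whi b n t \<longleftrightarrow>
    feasible_equilibrium M wstar wlo whi b n t \<and>
    (\<forall>n' t'. feasible_equilibrium M wstar wlo whi b n' t' \<longrightarrow>
      partition_loss \<pi> n t \<le> partition_loss \<pi> n' t')"
proof -
  have part: "interval_partition wlo whi n t" if "feasible_equilibrium M wstar wlo whi b n t" for n t
    using that by (simp add: feasible_equilibrium_def)
  show ?thesis
    unfolding user_optimal_equilibrium_def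
    using reporting_strategy_exists[OF part] ex_ante_user_utility_eq[OF part]
    by (smt (verit, best))
qed

end

theorem theorem5p3:
  fixes M :: "'d measure" and wstar :: "'d \<Rightarrow> real" and wlo whi b :: real
  assumes "prob_space M"
    and "wstar \<in> borel_measurable M"
    and "\<And>D. D \<in> space M \<Longrightarrow> wstar D \<in> {wlo..whi}"
    and "atomless (prior M wstar)"
    and "topological_support (prior M wstar) = {wlo..whi}"
    and "b > 0"
  shows "(\<forall>n t. feasible_equilibrium M wstar wlo whi b n t \<longleftrightarrow>
            interval_partition wlo whi n t \<and> int n \<le> Nmax wlo whi b \<and>
            cutpoint_condition (prior M wstar) b n t) \<and>
         (\<forall>n t. user_optimal_equilibrium M wstar wlo whi b n t \<longleftrightarrow>
            is_arg_min (\<lambda>(n, t). partition_loss (prior M wstar) n t)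
              (\<lambda>(n, t). interval_partition wlo whi n t \<and> int n \<le> Nmax wlo whi b \<and>
                 cutpoint_condition (prior M wstar) b n t) (n, t)) \<and>
         (\<forall>n t. user_optimal_equilibrium M wstar wlo whi b n t \<longrightarrow>
            (\<forall>D \<in> space M. \<forall>i \<in> {1..n}. wstar D \<in> {t (i - 1)..t i} \<longrightarrow>
               {t (i - 1)..t i} \<in> optimal_reports M wstar b n t D \<and>
               (\<forall>R \<in> optimal_reports M wstar b n t D. wstar D \<in> R)))"
proof -
  interpret communication_game M wstar wlo whi b
    using assms by (intro communication_game.intro communication_game_axioms.intro)
  have "user_optimal_equilibrium M wstar wlo whi b n t \<longleftrightarrow>
      is_arg_min (\<lambda>(n, t). partition_loss (prior M wstar) n t)
        (\<lambda>(n, t). interval_partition wlo whi n t \<and> int n \<le> Nmax wlo whi b \<and>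
           cutpoint_condition (prior M wstar) b n t) (n, t)" for n t
    \<comment> \<open>\<open>is_arg_min\<close> excludes strictly smaller values, which for reals is
      the same as being a lower bound.\<close>
    unfolding user_optimal_iff feasible_iff is_arg_min_def by (auto simp: not_less)
  moreover have "{t (i - 1)..t i} \<in> optimal_reports M wstar b n t D \<and>
      (\<forall>R \<in> optimal_reports M wstar b n t D. wstar D \<in> R)"
    if "user_optimal_equilibrium M wstar wlo whi b n t" "D \<in> space M" "i \<in> {1..n}"
      "wstar D \<in> {t (i - 1)..t i}" for n t D i
    using cutpoint_optimal_reports that unfolding user_optimal_iff feasible_iff by blast
  ultimately show ?thesis
    using feasible_iff by blast
qed

end
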